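(* The functions $\mathrm{ord}\colon \mathcal{P} \to \mathcal{P}_{\mathrm{2reg}}$ and $\mathrm{calc}\colon \mathcal{P}_{\mathrm{2reg}} \to \mathcal{P}$ are mutually inverse bijections. Moreover, for every $\mu\in\mathcal{P}_{\mathrm{2reg}}$, the tableau generated in the construction of $\mathrm{calc}(\mu)$ is exactly $\mathrm{spar}(\mathrm{calc}(\mu))$.
   Context: Integer partitions $\lambda=(\lambda_1\ge\lambda_2\ge\cdots)$ are identified with Young diagrams in the English convention (left-aligned, row $k$ from the top has $\lambda_k$ boxes). $c_t(\lambda)$ is the length of the $t$th column and $c(\lambda)$ the number of nonzero columns. $\lambda$ is 2-regular if no two of its (nonzero) rows have equal length. $\mathcal{P}$ is the set of partitions, $\mathcal{P}_{\mathrm{2reg}}$ the set of 2-regular partitions. The spar tableau $\mathrm{spar}(\lambda)$ is the labeling of the boxes of $\lambda$ by positive integers defined as follows: traversing the columns from right to left, and each column from bottom to top, label each box with the smallest positive integer which exceeds the labels of the boxes directly below it and directly to its right (if these exist), and which appears nowhere in the column immediately to the right. The function $\mathrm{ord}$: $\mathrm{ord}(\lambda)$ is the unique 2-regular partition $\mu$ such that, for all $t\geq 1$, $c_t(\mu)$ is odd if and only if $t$ appears in the first column of $\mathrm{spar}(\lambda)$. The function $\mathrm{calc}$: given a 2-regular partition $\mu$, a (tableau for a) partition $\lambda=\mathrm{calc}(\mu)$ is constructed as follows. The first column of $\lambda$ consists of boxes labeled by $\{t\in[1,c(\mu)] \mid c_t(\mu)\text{ is odd}\}$ in decreasing order from top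 to bottom. Then, beginning from the second column, traverse the columns from left to right, and within each column from top to bottom, placing labeled boxes by the rule: label each new box with the largest positive integer which is strictly less than every entry directly above or directly to the left of the new box, and appears nowhere in the column immediately to the left. If no such integer exists, or if there is no box immediately to its left, terminate this column without placing this box and move on to the next column to the right. The construction halts when a column receives no new boxes, and the resulting partition is $\lambda=\mathrm{calc}(\mu)$. *)

theory Defs
  imports Main
begin

(* Partitions are lists of row lengths, from the top row downwards. *)

definition partitions :: "nat list set" where
  "partitions = {rs. sorted_wrt (\<ge>) rs \<and> (\<forall>r\<in>set rs. 0 < r)}"

definition two_regular :: "nat list \<Rightarrow> bool" where
  "two_regular rs \<longleftrightarrow> distinct rs"

definition partitions_2reg :: "nat list set" where
  "partitions_2reg = {rs \<in> partitions. two_regular rs}"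

(* Columns are numbered from 1. *)
definition col_len :: "nat list \<Rightarrow> nat \<Rightarrow> nat" where
  "col_len rs t = length (filter (\<lambda>r. t \<le> r) rs)"

definition num_cols :: "nat list \<Rightarrow> nat" where
  "num_cols rs = card {t. 1 \<le> t \<and> col_len rs t \<noteq> 0}"

(* A tableau is the list of its columns, from left to right; each column is the list
   of its labels, from top to bottom. *)
type_synonym tableau = "nat list list"

definition first_col :: "tableau \<Rightarrow> nat list" where
  "first_col T = (case T of [] \<Rightarrow> [] | C # _ \<Rightarrow> C)"

(* The partition of which T is a tableau, provided the columns of T are nonempty and of
   weakly decreasing length: row i (counted from 0) has one box for each column that is
   longer than i. *)
definition shape :: "tableau \<Rightarrow> nat list" where
  "shape T = map (\<lambda>i. length (filter (\<lambda>C. i < length C) T)) [0..<length (first_col T)]"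


(* R is the column immediately to the right ([] if there is none); C holds the labels
   already placed, that is, those of the rows i, i + 1, ... where i is the second argument.
   The next box is in row i - 1, and rows are counted from 0. *)
primrec spar_col_aux :: "nat list \<Rightarrow> nat \<Rightarrow> nat list \<Rightarrow> nat list" where
  "spar_col_aux R 0 C = C"
| "spar_col_aux R (Suc i) C =
     spar_col_aux R i
       ((LEAST n. 0 < n \<and> (C \<noteq> [] \<longrightarrow> hd C < n) \<and> (i < length R \<longrightarrow> R ! i < n) \<and> n \<notin> set R) # C)"

definition spar_col :: "nat list \<Rightarrow> nat \<Rightarrow> nat list" where
  "spar_col R m = spar_col_aux R m []"

definition spar :: "nat list \<Rightarrow> tableau" where
  "spar rs = foldr (\<lambda>t T. spar_col (first_col T) (col_len rs t) # T) [1..<Suc (num_cols rs)] []"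

definition ord_partition :: "nat list \<Rightarrow> nat list" where
  "ord_partition rs = (THE \<mu>. \<mu> \<in> partitions_2reg \<and>
     (\<forall>t\<ge>1. odd (col_len \<mu> t) \<longleftrightarrow> t \<in> set (first_col (spar rs))))"


definition calc_first_col :: "nat list \<Rightarrow> nat list" where
  "calc_first_col \<mu> = rev (sorted_list_of_set {t \<in> {1..num_cols \<mu>}. odd (col_len \<mu> t)})"

(* L is the full column immediately to the left. The second argument is the entry directly
   above the next box (None in the top row), and the third is the part of L from the row of
   the next box downwards; its exhaustion means that there is no box immediately to the left. *)
fun calc_col_aux :: "nat list \<Rightarrow> nat option \<Rightarrow> nat list \<Rightarrow> nat list" where
  "calc_col_aux L up [] = []"
| "calc_col_aux L up (x # xs) =
     (let S = {n. 0 < n \<and> n < x \<and> (\<forall>a. up = Some a \<longrightarrow> n < a) \<and> n \<notin> set L}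
      in if S = {} then [] else Max S # calc_col_aux L (Some (Max S)) xs)"

definition calc_col :: "nat list \<Rightarrow> nat list" where
  "calc_col L = calc_col_aux L None L"

function calc_cols :: "nat list \<Rightarrow> tableau" where
  "calc_cols C = (if C = [] then [] else C # calc_cols (calc_col C))"
  by pat_completeness auto
termination
proof (relation "measure (\<lambda>C. case C of [] \<Rightarrow> 0 | x # _ \<Rightarrow> Suc x)")
  fix C :: "nat list"
  assume "C \<noteq> []"
  then obtain x xs where C: "C = x # xs" by (cases C) auto
  define S where "S = {n. 0 < n \<and> n < x \<and> n \<notin> set C}"
  have "finite S" unfolding S_def by auto
  then have "S \<noteq> {} \<Longrightarrow> Max S < x" using Max_in[of S] by (auto simp: S_def)
  moreover have "calc_col C = (if S = {} then [] else Max S # calc_col_aux C (Some (Max S)) xs)"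
    by (simp add: calc_col_def C S_def Let_def del: set_simps)
  ultimately show "(calc_col C, C) \<in> measure (\<lambda>C. case C of [] \<Rightarrow> 0 | x # _ \<Rightarrow> Suc x)"
    by (simp add: C)
qed simp

declare calc_cols.simps [simp del]

definition calc_tableau :: "nat list \<Rightarrow> tableau" where
  "calc_tableau \<mu> = calc_cols (calc_first_col \<mu>)"

definition calc_partition :: "nat list \<Rightarrow> nat list" where
  "calc_partition \<mu> = shape (calc_tableau \<mu>)"


(* The description in ord_partition determines a unique partition. *)

lemma col_len_distinct: "distinct rs \<Longrightarrow> col_len rs t = card {r \<in> set rs. t \<le> r}"
  unfolding col_len_def by (metis distinct_card distinct_filter set_filter)

lemma col_len_step:
  assumes "distinct rs"
  shows "col_len rs t = col_len rs (Suc t) + (if t \<in> set rs then 1 else 0)"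
proof -
  have "{r \<in> set rs. t \<le> r} = {r \<in> set rs. Suc t \<le> r} \<union> (if t \<in> set rs then {t} else {})"
    by (auto simp: Suc_le_eq le_less)
  then show ?thesis using assms by (auto simp: col_len_distinct)
qed

lemma ex1_2reg_odd_cols:
  assumes "finite S"
  shows "\<exists>!\<mu>. \<mu> \<in> partitions_2reg \<and> (\<forall>t\<ge>1. odd (col_len \<mu> t) \<longleftrightarrow> t \<in> S)"
proof (rule ex_ex1I)
  define D where "D = {t. 1 \<le> t \<and> (t \<in> S) \<noteq> (Suc t \<in> S)}"
  have "D \<subseteq> S \<union> (\<lambda>t. t - 1) ` S" unfolding D_def by force
  then have fin: "finite D" using assms finite_subset by blast
  define \<mu> where "\<mu> = rev (sorted_list_of_set D)"
  have \<mu>: "set \<mu> = D" "distinct \<mu>" "sorted_wrt (\<ge>) \<mu>"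
    using fin by (auto simp: \<mu>_def sorted_wrt_rev)
  obtain N where N: "\<And>t. t \<in> S \<union> D \<Longrightarrow> t \<le> N"
    using assms fin finite_nat_set_iff_bounded_le[of "S \<union> D"] by auto
  have "odd (col_len \<mu> t) \<longleftrightarrow> t \<in> S" if "1 \<le> t" for t
  proof (cases "t \<le> Suc N")
    case True
    then show ?thesis using that
    proof (induction t rule: inc_induct)
      case base
      have "{r \<in> D. Suc N \<le> r} = {}" "Suc N \<notin> S" using N by fastforce+
      then show ?case using \<mu> by (metis card.empty col_len_distinct even_zero)
    next
      case (step n)
      then show ?case using col_len_step[OF \<mu>(2), of n] \<mu>(1) by (auto simp: D_def)
    qed
  next
    case False
    then have "{r \<in> D. t \<le> r} = {}" "t \<notin> S" using N by fastforce+
    then show ?thesis using \<mu> by (metis card.empty col_len_distinct even_zero)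
  qed
  moreover have "\<mu> \<in> partitions_2reg"
    using \<mu> by (auto simp: partitions_2reg_def partitions_def two_regular_def D_def)
  ultimately show "\<exists>\<mu>. \<mu> \<in> partitions_2reg \<and> (\<forall>t\<ge>1. odd (col_len \<mu> t) \<longleftrightarrow> t \<in> S)" by blast
next
  have rows: "set \<mu> = {t. 1 \<le> t \<and> (t \<in> S) \<noteq> (Suc t \<in> S)}"
    if "\<mu> \<in> partitions_2reg" "\<forall>t\<ge>1. odd (col_len \<mu> t) \<longleftrightarrow> t \<in> S" for \<mu>
  proof -
    have d: "distinct \<mu>" and pos: "\<And>r. r \<in> set \<mu> \<Longrightarrow> 1 \<le> r"
      using that(1) by (auto simp: partitions_2reg_def partitions_def two_regular_def Suc_le_eq)
    have "t \<in> set \<mu> \<longleftrightarrow> (t \<in> S) \<noteq> (Suc t \<in> S)" if "1 \<le> t" for t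
    proof -
      have "odd (col_len \<mu> t) \<longleftrightarrow> t \<in> S" "odd (col_len \<mu> (Suc t)) \<longleftrightarrow> Suc t \<in> S"
        using that \<open>\<forall>t\<ge>1. odd (col_len \<mu> t) \<longleftrightarrow> t \<in> S\<close> by auto
      then show ?thesis using col_len_step[OF d, of t] by (auto split: if_splits)
    qed
    then show ?thesis using pos by auto
  qed
  fix \<mu> \<nu>
  assume *: "\<mu> \<in> partitions_2reg \<and> (\<forall>t\<ge>1. odd (col_len \<mu> t) \<longleftrightarrow> t \<in> S)"
    "\<nu> \<in> partitions_2reg \<and> (\<forall>t\<ge>1. odd (col_len \<nu> t) \<longleftrightarrow> t \<in> S)"
  then have "set \<mu> = set \<nu>" using rows by simp
  then have "rev \<mu> = rev \<nu>"
    using * by (intro sorted_distinct_set_unique)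
      (auto simp: partitions_2reg_def partitions_def two_regular_def sorted_wrt_rev)
  then show "\<mu> = \<nu>" by simp
qed

lemma ord_partition_characterization:
  "ord_partition rs \<in> partitions_2reg \<and>
   (\<forall>t\<ge>1. odd (col_len (ord_partition rs) t) \<longleftrightarrow> t \<in> set (first_col (spar rs)))"
  unfolding ord_partition_def by (rule theI') (rule ex1_2reg_odd_cols, simp)

end

theory Submission
  imports Defs
begin

text \<open>
  Both constructions work column by column: the rule for spar computes a column \<open>L\<close> from the
  column \<open>R\<close> on its right and the length of \<open>L\<close>, and the rule for calc computes \<open>R\<close> from \<open>L\<close>
  alone. The point is that the two rules are inverse to each other, and this holds because
  both say the same thing about the pair. Call \<open>L\<close> and \<open>R\<close> linked if both are strictly
  decreasing columns of positive integers, \<open>R\<close> is not longer than \<open>L\<close>, no label occurs in both,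
  each row decreases from \<open>L\<close> to \<open>R\<close>, and each positive \<open>n\<close> that is in neither column satisfies

    \<open>n < L ! i\<close> implies \<open>i < length R\<close> and \<open>n < R ! i\<close>.

  The last condition is the extremality in both rules. A violation \<open>n\<close>, \<open>i\<close> with \<open>i\<close>
  as large as possible is a positive integer that the rule for spar should have preferred to
  \<open>L ! i\<close>; a violation with \<open>i\<close> as small as possible is one that the rule for calc should have
  preferred to \<open>R ! i\<close>, or placed below the last box of \<open>R\<close>. Thus both rules produce linked
  columns (\<open>linked_spar_col\<close>, \<open>linked_calc_col\<close>), and linked columns determine each other
  by these rules (\<open>spar_col_linked\<close>, \<open>calc_col_linked\<close>).

  Consequently both kinds of tableaux are the tableaux whose adjacent columns are
  linked, where the last column is linked to an empty one. Such a tableau is determined by its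
  first column, by way of calc, and by its shape, by way of spar. The theorem
  follows since the first column of a tableau and the 2-regular partition attached to it by
  parity of column lengths also determine each other.
\<close>

section \<open>Linked columns\<close>

definition column :: "nat list \<Rightarrow> bool" where
  "column C \<longleftrightarrow> sorted_wrt (>) C \<and> (\<forall>x\<in>set C. 0 < x)"

text \<open>
  The list \<open>C\<close> is the part of the left column from row \<open>i\<close> downwards, so that the invariant
  makes sense while the left column is being filled from the bottom, whereas \<open>R\<close> is the whole
  right column. For \<open>i = 0\<close> this is the symmetric relation between two full columns.
\<close>
definition linked_below :: "nat \<Rightarrow> nat list \<Rightarrow> nat list \<Rightarrow> bool" where
  "linked_below i C R \<longleftrightarrow> column C \<and> column R \<and> length R \<le> i + length C \<and>
     (\<forall>j<length C. i + j < length R \<longrightarrow> R ! (i + j) < C ! j) \<and>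
     set C \<inter> set R = {} \<and>
     (\<forall>n>0. \<forall>j<length C. n < C ! j \<longrightarrow> n \<notin> set C \<longrightarrow> n \<notin> set R \<longrightarrow>
        i + j < length R \<and> n < R ! (i + j))"

abbreviation linked :: "nat list \<Rightarrow> nat list \<Rightarrow> bool" where
  "linked \<equiv> linked_below 0"

lemma column_Cons: "column (x # C) \<longleftrightarrow> 0 < x \<and> (C \<noteq> [] \<longrightarrow> hd C < x) \<and> column C"
  by (cases C) (auto simp: column_def)

lemma column_nth_less: "column C \<Longrightarrow> i < j \<Longrightarrow> j < length C \<Longrightarrow> C ! j < C ! i"
  by (auto simp: column_def sorted_wrt_iff_nth_less)

lemma column_drop: "column C \<Longrightarrow> column (drop i C)"
  by (auto simp: column_def sorted_wrt_drop dest: in_set_dropD)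

lemma column_eq_if_set_eq:
  assumes "column C" "column D" "set C = set D"
  shows "C = D"
proof -
  have "rev C = rev D"
    using assms by (intro strict_sorted_equal) (auto simp: column_def sorted_wrt_rev)
  then show ?thesis by simp
qed

lemma linkedD:
  assumes "linked L R"
  shows "column L" "column R" "length R \<le> length L"
    and "i < length R \<Longrightarrow> R ! i < L ! i"
    and "x \<in> set L \<Longrightarrow> x \<notin> set R"
    and "0 < n \<Longrightarrow> i < length L \<Longrightarrow> n < L ! i \<Longrightarrow> n \<notin> set L \<Longrightarrow> n \<notin> set R \<Longrightarrow>
           i < length R \<and> n < R ! i"
  using assms unfolding linked_below_def by (auto simp: disjoint_iff)

section \<open>The rule for spar\<close>

text \<open>
  If \<open>n\<close> lies below the new label and is in neither column, then either \<open>n\<close> is also below the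
  next label down, and the invariant there passes to row \<open>i\<close> since \<open>R\<close> decreases, or \<open>n\<close>
  competes with the new label, and only the box to the right can have ruled it out.
\<close>
lemma linked_below_step:
  assumes "linked_below (Suc i) C R"
  shows "linked_below i
    ((LEAST n. 0 < n \<and> (C \<noteq> [] \<longrightarrow> hd C < n) \<and> (i < length R \<longrightarrow> R ! i < n) \<and> n \<notin> set R) # C) R"
    (is "linked_below i ((LEAST n. ?P n) # C) R")
proof -
  define x where "x = (LEAST n. ?P n)"
  \<comment> \<open>some label exceeding all entries of both columns, so that the least one exists\<close>
  have "?P (Suc (sum_list C + sum_list R))"
    using member_le_sum_list[of _ C] member_le_sum_list[of _ R]
    by (force simp: less_Suc_eq_le trans_le_add1 trans_le_add2)
  then have P: "?P x" unfolding x_def by (rule LeastI)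
  have min: "x \<le> n" if "?P n" for n unfolding x_def using that by (rule Least_le)
  have C: "column C" "column R" "length R \<le> Suc i + length C" "set C \<inter> set R = {}"
    and above: "\<And>j. j < length C \<Longrightarrow> Suc i + j < length R \<Longrightarrow> R ! (Suc i + j) < C ! j"
    and gap: "\<And>n j. 0 < n \<Longrightarrow> j < length C \<Longrightarrow> n < C ! j \<Longrightarrow> n \<notin> set C \<Longrightarrow> n \<notin> set R
        \<Longrightarrow> Suc i + j < length R \<and> n < R ! (Suc i + j)"
    using assms unfolding linked_below_def by auto
  have top: "i < length R \<and> n < R ! i" if n: "0 < n" "n < x" "n \<notin> set C" "n \<notin> set R" for n
  proof (cases "C \<noteq> [] \<and> n < hd C")
    case True
    then have "Suc i < length R \<and> n < R ! Suc i"
      using gap[of n 0] n by (auto simp: hd_conv_nth)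
    then show ?thesis using column_nth_less[OF C(2), of i "Suc i"] by auto
  next
    case False
    then have "C \<noteq> [] \<longrightarrow> hd C < n" using n(3) by (metis hd_in_set linorder_neqE_nat)
    moreover have "\<not> ?P n" using min[of n] n(2) by auto
    ultimately have "i < length R \<and> \<not> R ! i < n" using n by auto
    then show ?thesis using n(4) by (metis linorder_neqE_nat nth_mem)
  qed
  have "linked_below i (x # C) R"
    unfolding linked_below_def
  proof (intro conjI allI impI)
    show "column (x # C)" using P C by (auto simp: column_Cons)
    show "column R" by fact
    show "length R \<le> i + length (x # C)" using C by simp
    show "set (x # C) \<inter> set R = {}" using P C by auto
  next
    fix j assume "j < length (x # C)" "i + j < length R"
    then show "R ! (i + j) < (x # C) ! j" using P above by (cases j) auto
  next
    fix n j assume n: "0 < n" "j < length (x # C)" "n < (x # C) ! j" "n \<notin> set (x # C)" "n \<notin> set R"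
    show "i + j < length R" using n top[of n] gap[of n "j - 1"] by (cases j) auto
    show "n < R ! (i + j)" using n top[of n] gap[of n "j - 1"] by (cases j) auto
  qed
  then show ?thesis unfolding x_def .
qed

lemma linked_below_spar_col_aux: "linked_below i C R \<Longrightarrow> linked (spar_col_aux R i C) R"
proof (induction i arbitrary: C)
  case (Suc i)
  then show ?case using linked_below_step[OF Suc.prems] by simp
qed simp

lemma linked_spar_col: "column R \<Longrightarrow> length R \<le> m \<Longrightarrow> linked (spar_col R m) R"
  unfolding spar_col_def
  by (rule linked_below_spar_col_aux) (simp add: linked_below_def column_def)

lemma length_spar_col: "length (spar_col R m) = m"
proof -
  have "length (spar_col_aux R m C) = m + length C" for C
    by (induction m arbitrary: C) auto
  then show ?thesis by (simp add: spar_col_def)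
qed

text \<open>
  A smaller candidate for the label of row \<open>i\<close> would be larger than everything below row \<open>i\<close> in
  \<open>L\<close>, hence in neither column; linkedness then puts it below \<open>R ! i\<close>, where it is no candidate.
\<close>
lemma spar_col_linked:
  assumes "linked L R"
  shows "spar_col R (length L) = L"
proof -
  have "spar_col_aux R i (drop i L) = L" if "i \<le> length L" for i
    using that
  proof (induction i)
    case (Suc i)
    let ?P = "\<lambda>n. 0 < n \<and> (drop (Suc i) L \<noteq> [] \<longrightarrow> hd (drop (Suc i) L) < n) \<and>
        (i < length R \<longrightarrow> R ! i < n) \<and> n \<notin> set R"
    have L: "drop i L = L ! i # drop (Suc i) L"
      using Suc.prems by (simp add: Cons_nth_drop_Suc)
    have col: "column (L ! i # drop (Suc i) L)"
      using column_drop[OF linkedD(1)[OF assms], of i] L by simp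
    have "(LEAST n. ?P n) = L ! i"
    proof (rule Least_equality)
      show "?P (L ! i)"
        using col Suc.prems linkedD(4)[OF assms, of i] linkedD(5)[OF assms, of "L ! i"]
        by (auto simp: column_Cons)
    next
      fix n assume n: "?P n"
      show "L ! i \<le> n"
      proof (rule ccontr)
        assume less: "\<not> L ! i \<le> n"
        have "n \<noteq> L ! j" if j: "j < length L" for j
        proof (cases "j \<le> i")
          case True
          then show ?thesis
            using column_nth_less[OF linkedD(1)[OF assms], of j i] less Suc.prems
            by (cases "j = i") auto
        next
          case False
          then have "L ! j \<le> L ! Suc i" "drop (Suc i) L \<noteq> []"
            using column_nth_less[OF linkedD(1)[OF assms], of "Suc i" j] j
            by (cases "j = Suc i"; auto)+
          then show ?thesis using n by (auto simp: hd_drop_conv_nth)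
        qed
        then have "n \<notin> set L" by (metis in_set_conv_nth)
        then show False using linkedD(6)[OF assms, of n i] n less Suc.prems by auto
      qed
    qed
    then show ?case using Suc L by simp
  qed simp
  from this[of "length L"] show ?thesis by (simp add: spar_col_def)
qed

section \<open>The rule for calc\<close>

text \<open>
  A positive integer in neither column that is less than the entry \<open>up\<close> above the current box
  and than some label of \<open>L\<close> in or under the current row is a candidate for that box, since \<open>L\<close>
  decreases. So if the column stops there is no such
  integer, and otherwise all of them are less than the label just placed, which bounds the
  candidates for the rest of the column.
\<close>
lemma calc_col_aux_linked:
  fixes up :: "nat option"
  assumes "column xs" "set xs \<subseteq> set L"
  defines "ys \<equiv> calc_col_aux L up xs"
  shows "column ys \<and> (\<forall>a y. up = Some a \<longrightarrow> y \<in> set ys \<longrightarrow> y < a) \<and> length ys \<le> length xs \<and>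
    (\<forall>i<length ys. ys ! i < xs ! i) \<and> set L \<inter> set ys = {} \<and>
    (\<forall>n>0. \<forall>i<length xs. n < xs ! i \<longrightarrow> (\<forall>a. up = Some a \<longrightarrow> n < a) \<longrightarrow> n \<notin> set L \<longrightarrow>
       n \<notin> set ys \<longrightarrow> i < length ys \<and> n < ys ! i)"
  using assms(1,2) unfolding ys_def
proof (induction xs arbitrary: up)
  case Nil
  then show ?case by (simp add: column_def)
next
  case (Cons x xs)
  define S where "S = {n. 0 < n \<and> n < x \<and> (\<forall>a. up = Some a \<longrightarrow> n < a) \<and> n \<notin> set L}"
  have eq: "calc_col_aux L up (x # xs) =
      (if S = {} then [] else Max S # calc_col_aux L (Some (Max S)) xs)"
    by (simp add: S_def Let_def)
  have le: "(x # xs) ! i \<le> x" if "i < length (x # xs)" for i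
    using column_nth_less[OF Cons.prems(1), of 0 i] that by (cases i) auto
  have inS: "n \<in> S" if "0 < n" "i < length (x # xs)" "n < (x # xs) ! i"
      "\<forall>a. up = Some a \<longrightarrow> n < a" "n \<notin> set L" for n i
    using that le[of i] by (auto simp: S_def)
  show ?case
  proof (cases "S = {}")
    case True
    have nil: "calc_col_aux L up (x # xs) = []" by (simp only: eq if_P[OF True])
    have "column []" by (simp add: column_def)
    moreover have "n \<in> set L" if "0 < n" "i < length (x # xs)" "n < (x # xs) ! i"
        "\<forall>a. up = Some a \<longrightarrow> n < a" for n i
      using inS[OF that] True by blast
    ultimately show ?thesis
      unfolding nil by (intro conjI allI impI) (simp_all only: list.size set_simps, blast+)
  next
    case False
    have fin: "finite S" unfolding S_def by auto
    define y where "y = Max S"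
    define ys where "ys = calc_col_aux L (Some y) xs"
    have yS: "y \<in> S" using fin False unfolding y_def by (rule Max_in)
    then have y: "0 < y" "y < x" "\<forall>a. up = Some a \<longrightarrow> y < a" "y \<notin> set L"
      by (auto simp: S_def)
    have ymax: "n \<le> y" if "n \<in> S" for n using fin that unfolding y_def by simp
    have "column xs" "set xs \<subseteq> set L" using Cons.prems by (auto simp: column_Cons)
    from Cons.IH[OF this, of "Some y"]
    have IH: "column ys" "\<And>z. z \<in> set ys \<Longrightarrow> z < y" "length ys \<le> length xs"
      "\<And>i. i < length ys \<Longrightarrow> ys ! i < xs ! i" "set L \<inter> set ys = {}"
      "\<And>n i. 0 < n \<Longrightarrow> i < length xs \<Longrightarrow> n < xs ! i \<Longrightarrow> n < y \<Longrightarrow> n \<notin> set L \<Longrightarrow> n \<notin> set ys \<Longrightarrow>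
          i < length ys \<and> n < ys ! i"
      unfolding ys_def by auto
    have gap: "i < length (y # ys) \<and> n < (y # ys) ! i"
      if n: "0 < n" "i < length (x # xs)" "n < (x # xs) ! i"
        "\<forall>a. up = Some a \<longrightarrow> n < a" "n \<notin> set L" "n \<notin> set (y # ys)" for n i
    proof -
      have "n < y" using ymax[OF inS[OF n(1-5)]] n(6) by auto
      then show ?thesis using n IH(6)[of n "i - 1"] by (cases i) auto
    qed
    have "calc_col_aux L up (x # xs) = y # ys"
      using False by (simp only: eq y_def ys_def if_False)
    moreover have "column (y # ys)" using y IH(1,2) by (auto simp: column_Cons)
    moreover have "(y # ys) ! i < (x # xs) ! i" if "i < length (y # ys)" for i
      using that y IH(4) by (cases i) auto
    moreover have "\<forall>a z. up = Some a \<longrightarrow> z \<in> set (y # ys) \<longrightarrow> z < a"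
      using y(3) IH(2) by fastforce
    moreover have "set L \<inter> set (y # ys) = {}" using y IH(5) by auto
    ultimately show ?thesis using gap IH(3) by (simp only: length_Cons) blast
  qed
qed

lemma linked_calc_col: "column L \<Longrightarrow> linked L (calc_col L)"
  using calc_col_aux_linked[of L L None] by (simp add: linked_below_def calc_col_def)

text \<open>
  A larger candidate for the label of row \<open>i\<close> would lie strictly between consecutive entries of
  \<open>R\<close>, hence in neither column; linkedness then puts it below \<open>R ! i\<close>. In the row after the last
  entry of \<open>R\<close>, linkedness excludes all candidates.
\<close>
lemma calc_col_linked:
  assumes "linked L R"
  shows "calc_col L = R"
proof -
  define up where "up i = (if i = 0 then None else Some (R ! (i - 1)))" for i
  have "calc_col_aux L (up i) (drop i L) = drop i R" if "i \<le> length R" for i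
    using that
  proof (induction i rule: inc_induct)
    case base
    show ?case
    proof (cases "length R < length L")
      case True
      let ?S = "{n. 0 < n \<and> n < L ! length R \<and>
        (\<forall>a. up (length R) = Some a \<longrightarrow> n < a) \<and> n \<notin> set L}"
      have "n \<notin> ?S" for n
      proof
        assume n: "n \<in> ?S"
        have "n < R ! j" if j: "j < length R" for j
        proof -
          have "n < R ! (length R - 1)" using n j by (cases "R = []") (auto simp: up_def)
          moreover have "j < length R - 1 \<or> j = length R - 1" "length R - 1 < length R"
            using j by auto
          ultimately show ?thesis
            using column_nth_less[OF linkedD(2)[OF assms], of j "length R - 1"]
            by (metis less_trans)
        qed
        then have "n \<notin> set R" by (metis in_set_conv_nth less_irrefl)
        then show False using linkedD(6)[OF assms, of n "length R"] n True by auto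
      qed
      then have "?S = {}" by blast
      moreover have "drop (length R) L = L ! length R # drop (Suc (length R)) L"
        using True by (simp add: Cons_nth_drop_Suc)
      ultimately show ?thesis by (simp add: Let_def)
    qed simp
  next
    case (step i)
    let ?S = "{n. 0 < n \<and> n < L ! i \<and> (\<forall>a. up i = Some a \<longrightarrow> n < a) \<and> n \<notin> set L}"
    have i: "i < length R" "i < length L" using step.hyps linkedD(3)[OF assms] by auto
    have mem: "R ! i \<in> ?S"
      using linkedD(4)[OF assms i(1)] linkedD(5)[OF assms, of "R ! i"] i
        linkedD(2)[OF assms] column_nth_less[OF linkedD(2)[OF assms], of "i - 1" i]
      by (auto simp: up_def column_def)
    have "Max ?S = R ! i"
    proof (rule Max_eqI)
      show "finite ?S" by auto
      show "R ! i \<in> ?S" by fact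
      fix n assume n: "n \<in> ?S"
      show "n \<le> R ! i"
      proof (rule ccontr)
        assume less: "\<not> n \<le> R ! i"
        have "n \<noteq> R ! j" if j: "j < length R" for j
        proof (cases "j < i")
          case True
          then have "up i = Some (R ! (i - 1))" by (simp add: up_def)
          then have "n < R ! (i - 1)" using n by simp
          moreover have "j < i - 1 \<or> j = i - 1" "i - 1 < length R" using True i by auto
          ultimately show ?thesis
            using column_nth_less[OF linkedD(2)[OF assms], of j "i - 1"]
            by (metis less_trans less_irrefl)
        next
          case False
          then show ?thesis
            using column_nth_less[OF linkedD(2)[OF assms], of i j] j less
            by (cases "j = i") auto
        qed
        then have "n \<notin> set R" by (metis in_set_conv_nth)
        then show False using linkedD(6)[OF assms, of n i] n less i by auto
      qed
    qed
    moreover have "?S \<noteq> {}" using mem by blast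
    moreover have "drop i L = L ! i # drop (Suc i) L" "drop i R = R ! i # drop (Suc i) R"
      using i by (simp_all add: Cons_nth_drop_Suc)
    moreover have "up (Suc i) = Some (R ! i)" by (simp add: up_def)
    ultimately show ?case using step.IH by (simp only: calc_col_aux.simps Let_def if_False)
  qed
  from this[of 0] show ?thesis by (simp add: calc_col_def up_def)
qed

section \<open>Tableaux with linked columns\<close>

primrec linked_tableau :: "tableau \<Rightarrow> bool" where
  "linked_tableau [] \<longleftrightarrow> True"
| "linked_tableau (C # T) \<longleftrightarrow> C \<noteq> [] \<and> linked C (first_col T) \<and> linked_tableau T"

lemma first_col_simps [simp]: "first_col [] = []" "first_col (C # T) = C"
  by (simp_all add: first_col_def)

lemma column_first_col: "linked_tableau T \<Longrightarrow> column (first_col T)"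
  by (cases T) (auto dest: linkedD(1), simp add: column_def)

lemma first_col_calc_cols [simp]: "first_col (calc_cols C) = C"
  by (subst calc_cols.simps) simp

lemma linked_tableau_calc_cols: "column C \<Longrightarrow> linked_tableau (calc_cols C)"
proof (induction C rule: calc_cols.induct)
  case (1 C)
  then show ?case
    using linked_calc_col[OF 1(2)] linkedD(2)[OF linked_calc_col[OF 1(2)]]
    by (subst calc_cols.simps) simp
qed

lemma calc_cols_first_col: "linked_tableau T \<Longrightarrow> calc_cols (first_col T) = T"
proof (induction T)
  case Nil
  then show ?case by (simp add: calc_cols.simps)
next
  case (Cons C T)
  then have "calc_col C = first_col T" by (simp add: calc_col_linked)
  with Cons show ?case by (subst calc_cols.simps) simp
qed

lemma linked_tableau_lengths: "linked_tableau T \<Longrightarrow> sorted_wrt (\<ge>) (map length T)"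
proof (induction T)
  case (Cons C T)
  then show ?case
    using linkedD(3)[of C "first_col T"] by (cases T) fastforce+
qed simp

text \<open>
  The spar tableau depends on the partition only through its column lengths, and
  recursion over these matches the recursion over the columns of a tableau.
\<close>
definition spar_of_lengths :: "nat list \<Rightarrow> tableau" where
  "spar_of_lengths ls = foldr (\<lambda>l T. spar_col (first_col T) l # T) ls []"

lemma spar_of_lengths_simps [simp]:
  "spar_of_lengths [] = []"
  "spar_of_lengths (l # ls) = spar_col (first_col (spar_of_lengths ls)) l # spar_of_lengths ls"
  by (simp_all add: spar_of_lengths_def)

lemma map_length_spar_of_lengths: "map length (spar_of_lengths ls) = ls"
  by (induction ls) (simp_all add: length_spar_col)

lemma linked_tableau_spar_of_lengths:
  "ls \<in> partitions \<Longrightarrow> linked_tableau (spar_of_lengths ls)"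
proof (induction ls)
  case (Cons l ls)
  let ?T = "spar_of_lengths ls"
  have T: "linked_tableau ?T" using Cons by (simp add: partitions_def)
  have "length (first_col ?T) \<le> l"
    using Cons.prems map_length_spar_of_lengths[of ls] by (cases ls; cases ?T) (auto simp: partitions_def)
  then show ?case
    using T Cons.prems linked_spar_col[OF column_first_col[OF T], of l] length_spar_col[of "first_col ?T" l]
    by (auto simp: partitions_def)
qed simp

lemma spar_of_lengths_linked: "linked_tableau T \<Longrightarrow> spar_of_lengths (map length T) = T"
  by (induction T) (simp_all add: spar_col_linked)

section \<open>Conjugation\<close>

definition col_lens :: "nat list \<Rightarrow> nat list" where
  "col_lens rs = map (col_len rs) [1..<Suc (num_cols rs)]"

definition conjugate :: "nat list \<Rightarrow> nat list" where
  "conjugate ls = map (\<lambda>i. length (filter (\<lambda>l. i < l) ls)) [0..<(case ls of [] \<Rightarrow> 0 | l # _ \<Rightarrow> l)]"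

lemma shape_eq_conjugate: "shape T = conjugate (map length T)"
  by (cases T) (simp_all add: shape_def conjugate_def filter_map o_def)

lemma spar_eq: "spar rs = spar_of_lengths (col_lens rs)"
  by (simp add: spar_def spar_of_lengths_def col_lens_def foldr_map o_def)

text \<open>
  The Galois connection behind conjugation: the box in row \<open>i\<close> and column \<open>t\<close> may be counted along
  its column or along its row.
\<close>
lemma less_length_filter_iff:
  assumes "sorted_wrt (\<ge>) rs"
  shows "i < length (filter (\<lambda>r. t \<le> r) rs) \<longleftrightarrow> i < length rs \<and> (t::nat) \<le> rs ! i"
  using assms
proof (induction rs arbitrary: i)
  case (Cons r rs)
  show ?case
  proof (cases "t \<le> r")
    case True
    then show ?thesis using Cons by (cases i) auto
  next
    case False
    then have "filter (\<lambda>r. t \<le> r) rs = []" using Cons.prems by (auto simp: filter_empty_conv)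
    moreover have "(r # rs) ! i \<le> r" if "i < length (r # rs)"
      using that Cons.prems by (cases i) auto
    ultimately show ?thesis using False by auto
  qed
qed simp

lemma nonzero_cols: "rs \<in> partitions \<Longrightarrow> {t. 1 \<le> t \<and> col_len rs t \<noteq> 0} = {1..(case rs of [] \<Rightarrow> 0 | r # _ \<Rightarrow> r)}"
  using less_length_filter_iff[of rs 0]
  by (auto simp: partitions_def col_len_def split: list.splits)

lemma num_cols_eq: "rs \<in> partitions \<Longrightarrow> num_cols rs = (case rs of [] \<Rightarrow> 0 | r # _ \<Rightarrow> r)"
  by (simp only: num_cols_def nonzero_cols card_atLeastAtMost diff_Suc_1)

lemma col_lens_eq: "rs \<in> partitions \<Longrightarrow> col_lens rs = conjugate rs"
  by (simp add: col_lens_def conjugate_def num_cols_eq col_len_def Suc_le_eq map_Suc_upt[symmetric] del: upt_Suc)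

lemma conjugate_partition:
  assumes "rs \<in> partitions"
  shows "conjugate rs \<in> partitions"
proof -
  have s: "sorted_wrt (\<ge>) rs" using assms by (simp add: partitions_def)
  have "length (filter (\<lambda>l. j < l) rs) \<le> length (filter (\<lambda>l. i < l) rs)" if "i < j" for i j
    using that by (induction rs) auto
  then show ?thesis
    using less_length_filter_iff[OF s, of 0]
    by (auto simp: partitions_def conjugate_def sorted_wrt_map sorted_wrt_iff_nth_less
        Suc_le_eq split: list.splits)
qed

lemma conjugate_conjugate:
  assumes "rs \<in> partitions"
  shows "conjugate (conjugate rs) = rs"
proof (cases rs)
  case Nil
  then show ?thesis by (simp add: conjugate_def)
next
  case (Cons r rs')
  have s: "sorted_wrt (\<ge>) rs" and pos: "\<And>x. x \<in> set rs \<Longrightarrow> 0 < x"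
    using assms by (auto simp: partitions_def)
  have r: "0 < r" using pos Cons by simp
  have le: "rs ! i \<le> r" if "i < length rs" for i
    using s that Cons by (cases i) auto
  have conj: "conjugate rs = map (\<lambda>i. length (filter (\<lambda>l. i < l) rs)) [0..<r]"
    by (simp add: conjugate_def Cons)
  have all: "filter (\<lambda>l. 0 < l) rs = rs" using pos by (simp add: filter_id_conv)
  then have hd: "(case conjugate rs of [] \<Rightarrow> 0 | l # _ \<Rightarrow> l) = length rs"
    unfolding conj using r by (simp add: upt_conv_Cons)
  have "length (filter (\<lambda>l. i < l) (conjugate rs)) = rs ! i" if i: "i < length rs" for i
  proof -
    have "filter (\<lambda>k. i < length (filter (\<lambda>l. k < l) rs)) [0..<r] = filter (\<lambda>k. k < rs ! i) [0..<r]"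
      using less_length_filter_iff[OF s, of i "Suc _"] i by (simp add: Suc_le_eq)
    moreover have "set (filter (\<lambda>k. k < rs ! i) [0..<r]) = {..<rs ! i}" using le[OF i] by auto
    then have "length (filter (\<lambda>k. k < rs ! i) [0..<r]) = rs ! i"
      using distinct_card[of "filter (\<lambda>k. k < rs ! i) [0..<r]"] by simp
    ultimately show ?thesis by (simp add: conj filter_map o_def)
  qed
  then have "map (\<lambda>i. length (filter (\<lambda>l. i < l) (conjugate rs))) [0..<length rs] = rs"
    by (intro nth_equalityI) auto
  then show ?thesis by (subst conjugate_def) (simp add: hd)
qed

section \<open>The two bijections\<close>

lemma linked_tableau_spar: "rs \<in> partitions \<Longrightarrow> linked_tableau (spar rs)"
  by (simp add: spar_eq col_lens_eq conjugate_partition linked_tableau_spar_of_lengths)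

lemma shape_spar: "rs \<in> partitions \<Longrightarrow> shape (spar rs) = rs"
  by (simp add: spar_eq col_lens_eq shape_eq_conjugate map_length_spar_of_lengths conjugate_conjugate)

lemma lengths_partition: "linked_tableau T \<Longrightarrow> map length T \<in> partitions"
proof -
  assume T: "linked_tableau T"
  then have "\<forall>C\<in>set T. C \<noteq> []" by (induction T) auto
  then show ?thesis using linked_tableau_lengths[OF T] by (auto simp: partitions_def)
qed

lemma shape_partition: "linked_tableau T \<Longrightarrow> shape T \<in> partitions"
  by (simp add: shape_eq_conjugate conjugate_partition lengths_partition)

text \<open>
  Passing to the shape and back to column lengths conjugates twice, so the tableau is rebuilt from
  the lengths of its own columns.
\<close>
lemma spar_shape: "linked_tableau T \<Longrightarrow> spar (shape T) = T"
  by (simp add: spar_eq col_lens_eq shape_partition)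
     (simp add: shape_eq_conjugate conjugate_conjugate lengths_partition spar_of_lengths_linked)

lemma column_calc_first_col: "column (calc_first_col \<mu>)"
  by (auto simp: column_def calc_first_col_def sorted_wrt_rev)

lemma set_calc_first_col:
  assumes "\<mu> \<in> partitions"
  shows "t \<in> set (calc_first_col \<mu>) \<longleftrightarrow> 1 \<le> t \<and> odd (col_len \<mu> t)"
proof -
  have "t \<le> num_cols \<mu>" if "1 \<le> t" "odd (col_len \<mu> t)"
  proof -
    have "t \<in> {t. 1 \<le> t \<and> col_len \<mu> t \<noteq> 0}" using that odd_pos by force
    then show ?thesis using assms by (simp only: nonzero_cols num_cols_eq) simp
  qed
  then show ?thesis by (auto simp: calc_first_col_def)
qed

lemma linked_tableau_calc_tableau: "linked_tableau (calc_tableau \<mu>)"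
  by (simp add: calc_tableau_def linked_tableau_calc_cols column_calc_first_col)

lemma ord_partition_2reg: "ord_partition rs \<in> partitions_2reg"
  using ord_partition_characterization by blast

lemma ord_partition_unique:
  assumes "\<mu> \<in> partitions_2reg" "set (calc_first_col \<mu>) = set (first_col (spar rs))"
  shows "ord_partition rs = \<mu>"
proof -
  have "\<forall>t\<ge>1. odd (col_len \<mu> t) \<longleftrightarrow> t \<in> set (first_col (spar rs))"
    using set_calc_first_col[of \<mu>] assms by (auto simp: partitions_2reg_def)
  then show ?thesis
    using ex1_2reg_odd_cols[of "set (first_col (spar rs))"] ord_partition_characterization[of rs]
      assms(1) by blast
qed

text \<open>
  The first column of calc is read off the parities that define ord, and a strictly decreasing
  column is determined by its set of labels; so calc restarts from the first column of the spar
  tableau, which determines the rest.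
\<close>
lemma calc_tableau_ord_partition:
  assumes "\<nu> \<in> partitions"
  shows "calc_tableau (ord_partition \<nu>) = spar \<nu>"
proof -
  let ?C = "first_col (spar \<nu>)"
  have T: "linked_tableau (spar \<nu>)" using assms by (rule linked_tableau_spar)
  have C: "column ?C" using T by (rule column_first_col)
  have "ord_partition \<nu> \<in> partitions" using ord_partition_2reg by (auto simp: partitions_2reg_def)
  then have "set (calc_first_col (ord_partition \<nu>)) = set ?C"
    using set_calc_first_col ord_partition_characterization[of \<nu>] C
    by (auto simp: column_def Suc_le_eq)
  then have "calc_first_col (ord_partition \<nu>) = ?C"
    by (rule column_eq_if_set_eq[OF column_calc_first_col C])
  then show ?thesis using calc_cols_first_col[OF T] by (simp add: calc_tableau_def)
qed

theorem theoremA: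
  "bij_betw ord_partition partitions partitions_2reg \<and>
   bij_betw calc_partition partitions_2reg partitions \<and>
   (\<forall>\<nu>\<in>partitions. calc_partition (ord_partition \<nu>) = \<nu>) \<and>
   (\<forall>\<mu>\<in>partitions_2reg. ord_partition (calc_partition \<mu>) = \<mu>) \<and>
   (\<forall>\<mu>\<in>partitions_2reg. calc_tableau \<mu> = spar (calc_partition \<mu>))"
proof -
  have tab: "spar (calc_partition \<mu>) = calc_tableau \<mu>" for \<mu>
    by (simp add: calc_partition_def spar_shape linked_tableau_calc_tableau)
  have calc: "calc_partition \<mu> \<in> partitions" for \<mu>
    by (simp add: calc_partition_def shape_partition linked_tableau_calc_tableau)
  have co: "\<forall>\<nu>\<in>partitions. calc_partition (ord_partition \<nu>) = \<nu>"
    by (simp add: calc_partition_def calc_tableau_ord_partition shape_spar)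
  have oc: "\<forall>\<mu>\<in>partitions_2reg. ord_partition (calc_partition \<mu>) = \<mu>"
    by (auto intro!: ord_partition_unique simp: tab calc_tableau_def)
  have "bij_betw ord_partition partitions partitions_2reg"
    by (rule bij_betw_byWitness[OF co oc]) (auto simp: ord_partition_2reg calc)
  moreover have "bij_betw calc_partition partitions_2reg partitions"
    by (rule bij_betw_byWitness[OF oc co]) (auto simp: ord_partition_2reg calc)
  ultimately show ?thesis using co oc tab by simp
qed

end
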